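(* Let $q\geq 3$ be a prime power, $m\geq 2$, $n=q^m-1$, and $2\le\delta\le n$. Then the dual code $\widetilde{\mathcal{C}}_{(q,n,\delta)}^{\perp}$ is a narrow-sense BCH code if and only if $$\delta=2\quad\text{or}\quad (q-1)q^{m-1}-q^{\lfloor \frac{m-1}{2}\rfloor}\leq \delta\leq (q-1)q^{m-1}-1.$$
   Context: Let $\alpha$ be a generator of $\mathbb{F}_{q^m}^*$; it is a primitive $n$-th root of unity for $n=q^m-1$. For an integer $j$ let $m_j(x)$ be the minimal polynomial of $\alpha^j$ over $\mathbb{F}_q$. For $2\le\delta\le n$ put $g_\delta(x)=\mathrm{lcm}(m_1(x),\dots,m_{\delta-1}(x))$. The narrow-sense BCH code with designed distance $\delta$ is the cyclic code of length $n$ over $\mathbb{F}_q$ (an ideal of $\mathbb{F}_q[x]/\langle x^n-1\rangle$) generated by $g_\delta(x)$, and $\widetilde{\mathcal{C}}_{(q,n,\delta)}$ is the cyclic code of length $n$ generated by $(x-1)g_\delta(x)$. The dual is taken with respect to the standard inner product, and "is a narrow-sense BCH code" means: equals the code generated by $g_{\delta'}(x)$, with respect to the same $\alpha$, for some $2\le\delta'\le n$. *)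

theory Defs
  imports
    "Jordan_Normal_Form.Matrix"
    "HOL-Computational_Algebra.Polynomial_Factorial"
    "HOL-Number_Theory.Cong"
    "HOL-Library.Cardinality"
begin

text \<open>
  The field extension is given by a homomorphism \<open>h\<close> from the base field \<open>'a\<close> into the
  extension field \<open>'b\<close>. The class \<open>field_gcd\<close> is what the library needs to form \<open>Lcm\<close> of
  polynomials; it does not restrict the field, since any field carries these operations with
  every nonzero element a unit, and the resulting \<open>Lcm\<close> is the monic least common multiple.
\<close>

definition min_poly :: "('a::field \<Rightarrow> 'b::field) \<Rightarrow> 'b \<Rightarrow> 'a poly" where
  "min_poly h \<beta> =
     (THE p. lead_coeff p = 1 \<and> poly (map_poly h p) \<beta> = 0 \<and>
        (\<forall>r. r \<noteq> 0 \<and> poly (map_poly h r) \<beta> = 0 \<longrightarrow> degree p \<le> degree r))"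

text \<open>
  A word \<open>c\<close> of length \<open>n\<close> is identified with the residue class of
  \<open>c\<^sub>0 + c\<^sub>1 x + \<dots>\<close> modulo \<open>x\<^sup>n - 1\<close>; the code is the ideal generated by the class of \<open>g\<close>.
\<close>

definition cyclic_code :: "nat \<Rightarrow> 'a::field poly \<Rightarrow> 'a vec set" where
  "cyclic_code n g =
     {c \<in> carrier_vec n. \<exists>f. [Poly (list_of_vec c) = f * g] (mod (monom 1 n - 1))}"

definition dual_code :: "nat \<Rightarrow> 'a::field vec set \<Rightarrow> 'a vec set" where
  "dual_code n C = {v \<in> carrier_vec n. \<forall>c\<in>C. v \<bullet> c = 0}"

definition bch_gen :: "('a::field_gcd \<Rightarrow> 'b::field) \<Rightarrow> 'b \<Rightarrow> nat \<Rightarrow> 'a poly" where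
  "bch_gen h \<alpha> \<delta> = Lcm ((\<lambda>j. min_poly h (\<alpha> ^ j)) ` {1..\<delta> - 1})"

definition bch_code :: "('a::field_gcd \<Rightarrow> 'b::field) \<Rightarrow> 'b \<Rightarrow> nat \<Rightarrow> nat \<Rightarrow> 'a vec set" where
  "bch_code h \<alpha> n \<delta> = cyclic_code n (bch_gen h \<alpha> \<delta>)"

definition bch_code_tilde :: "('a::field_gcd \<Rightarrow> 'b::field) \<Rightarrow> 'b \<Rightarrow> nat \<Rightarrow> nat \<Rightarrow> 'a vec set" where
  "bch_code_tilde h \<alpha> n \<delta> = cyclic_code n ([:-1, 1:] * bch_gen h \<alpha> \<delta>)"

definition is_narrow_sense_bch ::
    "('a::field_gcd \<Rightarrow> 'b::field) \<Rightarrow> 'b \<Rightarrow> nat \<Rightarrow> 'a vec set \<Rightarrow> bool" where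
  "is_narrow_sense_bch h \<alpha> n C \<longleftrightarrow> (\<exists>\<delta>'. 2 \<le> \<delta>' \<and> \<delta>' \<le> n \<and> C = bch_code h \<alpha> n \<delta>')"

end

theory Submission
  imports Defs "Jordan_Normal_Form.Char_Poly"
begin

text \<open>
  A code cut out by prescribed zeros \<open>\<alpha>\<^sup>t\<close>, \<open>t \<in> T\<close>, with \<open>T\<close> closed under multiplication by \<open>q\<close>,
  determines \<open>T\<close>, and its dual has the zeros \<open>\<alpha>\<^sup>j\<close> with \<open>-j \<notin> T\<close>: one inclusion is
  Parseval's identity, the other tests against the words \<open>(Tr (x \<alpha>\<^sup>i\<^sup>j))\<^sub>i\<close>. So the dual is a
  narrow-sense BCH code of designed distance \<open>\<delta>'\<close> iff, for nonzero residues, \<open>j\<close> is conjugate to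
  some \<open>i < \<delta>'\<close> exactly when \<open>-j\<close> is not conjugate to any \<open>i < \<delta>\<close>, a condition symmetric in
  \<open>\<delta>\<close> and \<open>\<delta>'\<close>.

  With \<open>\<delta>\<^sub>1\<close> and \<open>\<delta>\<^sub>2\<close> the two largest coset leaders, \<open>\<delta>\<^sub>2 < \<delta> \<le> \<delta>\<^sub>1\<close> corresponds to \<open>\<delta>' = 2\<close>,
  since the coset of \<open>\<delta>\<^sub>1\<close> is the negative of the coset of \<open>1\<close>. If \<open>3 \<le> \<delta> \<le> \<delta>\<^sub>2\<close>, the
  condition forces both \<open>\<delta>\<close> and \<open>\<delta>'\<close> below \<open>q\<^bsup>m-1\<^esup>\<close>, which contradicts the one-element cosets
  of \<open>u = 1 + q + \<dots> + q\<^bsup>m-1\<^esup>\<close> and \<open>-u = (q - 2) u\<close>.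
\<close>

subsection \<open>Cyclotomic cosets modulo \<open>q\<^sup>m - 1\<close>\<close>

locale power_minus_one =
  fixes q m n :: nat
  assumes q_ge: "q \<ge> 3" and m_ge: "m \<ge> 2" and n_def: "n = q ^ m - 1"
begin

text \<open>Exponents are arbitrary naturals, not residues. The predicate describes which powers
  \<open>\<alpha> ^ j\<close> are zeros of \<open>bch_gen h \<alpha> \<delta>\<close>.\<close>

definition coset_below :: "nat \<Rightarrow> nat \<Rightarrow> bool" where
  "coset_below \<delta> j \<longleftrightarrow> (\<exists>i k. 1 \<le> i \<and> i < \<delta> \<and> [j * q ^ k = i] (mod n))"

text \<open>The condition \<open>n dvd j + t\<close> encodes \<open>t = -j\<close> without
  subtraction. Multiples of \<open>n\<close> are set apart because they are governed by the factor
  \<open>x - 1\<close> of the generator.\<close>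

definition complementary :: "nat \<Rightarrow> nat \<Rightarrow> bool" where
  "complementary \<delta> \<delta>' \<longleftrightarrow>
     (\<forall>j t. n dvd j + t \<longrightarrow> \<not> n dvd j \<longrightarrow> (coset_below \<delta>' j \<longleftrightarrow> \<not> coset_below \<delta> t))"

lemma power_m: "q ^ m = n + 1"
  using q_ge by (simp add: n_def)

lemma power_m': "q * q ^ (m - 1) = n + 1"
  using m_ge power_m by (metis power_eq_if not_numeral_le_zero)

lemma power_pos: "q ^ k > 0"
  using q_ge by simp

lemma power_pred_ge: "q ^ (m - 1) \<ge> q"
  using q_ge m_ge self_le_power[of q "m - 1"] by simp

lemma n_ge: "n \<ge> 8"
proof -
  have "3 * 3 \<le> q * q ^ (m - 1)"
    using q_ge power_pred_ge by (intro mult_mono) auto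
  then show ?thesis
    using power_m' by simp
qed

lemma cong_add_modulus: "[n + a = a] (mod n)"
  by (metis cong_def mod_add_self1)

lemma cong_power_m: "[q ^ m = 1] (mod n)"
  unfolding power_m by (rule cong_add_modulus)

lemma cong_power_mult_m: "[q ^ (m * k) = 1] (mod n)"
  using cong_pow[OF cong_power_m, of k] by (simp add: power_mult)

lemma cong_power_mod: "[q ^ k = q ^ (k mod m)] (mod n)"
proof -
  have "q ^ k = q ^ (m * (k div m)) * q ^ (k mod m)"
    by (simp flip: power_add)
  also have "[\<dots> = 1 * q ^ (k mod m)] (mod n)"
    by (intro cong_mult cong_power_mult_m cong_refl)
  finally show ?thesis by simp
qed

text \<open>The two exponents add up to \<open>m * k\<close>. Powers of \<open>q\<close> are thus
  units modulo \<open>n\<close>, which lets conjugacy be reversed.\<close>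

lemma cong_power_inverse: "[q ^ k * q ^ (k * (m - 1)) = 1] (mod n)"
proof -
  have "q ^ k * q ^ (k * (m - 1)) = q ^ (m * k)"
    using m_ge by (cases m) (simp_all add: algebra_simps flip: power_add)
  then show ?thesis using cong_power_mult_m by simp
qed

lemma coset_below_cong_mult:
  assumes "coset_below \<delta> j" "[j * q ^ k = j'] (mod n)"
  shows "coset_below \<delta> j'"
proof -
  obtain i l where i: "1 \<le> i" "i < \<delta>" "[j * q ^ l = i] (mod n)"
    using assms(1) unfolding coset_below_def by auto
  have "[j' * q ^ (k * (m - 1) + l) = j * q ^ k * q ^ (k * (m - 1) + l)] (mod n)"
    using assms(2) by (intro cong_mult cong_refl) (simp add: cong_sym)
  also have "j * q ^ k * q ^ (k * (m - 1) + l) = (q ^ k * q ^ (k * (m - 1))) * (j * q ^ l)"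
    by (simp add: power_add algebra_simps)
  also have "[\<dots> = 1 * i] (mod n)"
    by (intro cong_mult cong_power_inverse i)
  finally show ?thesis using i unfolding coset_below_def by auto
qed

lemma coset_below_cong: "[j = j'] (mod n) \<Longrightarrow> coset_below \<delta> j \<longleftrightarrow> coset_below \<delta> j'"
  using coset_below_cong_mult[of \<delta> _ 0] by (auto simp: cong_sym_eq)

lemma coset_belowI: "1 \<le> i \<Longrightarrow> i < \<delta> \<Longrightarrow> [i * q ^ k = j] (mod n) \<Longrightarrow> coset_below \<delta> j"
  by (rule coset_below_cong_mult[of \<delta> i k])
     (unfold coset_below_def, metis cong_refl mult.right_neutral power_0)

text \<open>Exponents of \<open>q\<close> matter only modulo \<open>m\<close>; the bound
  \<open>k < m\<close> feeds the later size estimates.\<close>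

lemma coset_below_less:
  assumes "coset_below \<delta> j"
  obtains i k where "1 \<le> i" "i < \<delta>" "k < m" "[j * q ^ k = i] (mod n)"
proof -
  obtain i k where i: "1 \<le> i" "i < \<delta>" "[j * q ^ k = i] (mod n)"
    using assms unfolding coset_below_def by auto
  have "[j * q ^ (k mod m) = j * q ^ k] (mod n)"
    by (intro cong_mult cong_refl cong_sym[OF cong_power_mod])
  with i have "[j * q ^ (k mod m) = i] (mod n)"
    by (meson cong_trans)
  with i that[of i "k mod m"] m_ge show thesis by simp
qed

text \<open>Here the conjugation runs from the small element to \<open>j\<close>, for use where
  \<open>i * q ^ k\<close> itself is to be bounded.\<close>

lemma coset_below_greater:
  assumes "coset_below \<delta> j"
  obtains i k where "1 \<le> i" "i < \<delta>" "k < m" "[i * q ^ k = j] (mod n)"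
proof -
  obtain i l where i: "1 \<le> i" "i < \<delta>" "[j * q ^ l = i] (mod n)"
    using assms unfolding coset_below_def by blast
  define k where "k = l * (m - 1) mod m"
  have "[i * q ^ k = j * q ^ l * q ^ (l * (m - 1))] (mod n)"
    unfolding k_def by (intro cong_mult cong_sym[OF i(3)] cong_sym[OF cong_power_mod])
  also have "j * q ^ l * q ^ (l * (m - 1)) = j * (q ^ l * q ^ (l * (m - 1)))"
    by (simp add: ac_simps)
  also have "[\<dots> = j * 1] (mod n)"
    by (intro cong_mult cong_power_inverse cong_refl)
  finally show thesis
    using that[of i k] i m_ge by (simp add: k_def)
qed

lemma not_coset_below_dvd:
  assumes "\<delta> \<le> n" "n dvd j"
  shows "\<not> coset_below \<delta> j"
proof
  assume "coset_below \<delta> j"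
  then obtain i k where i: "1 \<le> i" "i < \<delta>" "[j * q ^ k = i] (mod n)"
    unfolding coset_below_def by auto
  have "n dvd i"
    using cong_dvd_iff[OF i(3)] assms(2) by simp
  with i assms show False by (auto dest: dvd_imp_le)
qed

lemma complementary_sym: "complementary \<delta> \<delta>' \<Longrightarrow> complementary \<delta>' \<delta>"
  unfolding complementary_def by (metis add.commute dvd_add_right_iff)

lemma complementaryD:
  "complementary \<delta> \<delta>' \<Longrightarrow> n dvd j + t \<Longrightarrow> \<not> n dvd j \<Longrightarrow> coset_below \<delta>' j \<longleftrightarrow> \<not> coset_below \<delta> t"
  unfolding complementary_def by blast

text \<open>Negation modulo \<open>n\<close> is well defined; the proof passes to
  \<open>int\<close>, where subtraction is exact.\<close>

lemma cong_neg:
  assumes "n dvd a + b" "n dvd c + d" "[a = c] (mod n)"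
  shows "[b = d] (mod n)"
proof -
  have "[int a + int b = int c + int d] (mod int n)"
    using assms(1,2) by (metis cong_0_iff cong_int_iff cong_sym cong_trans of_nat_add of_nat_0)
  then have "[int a + int b - int a = int c + int d - int c] (mod int n)"
    using assms(3) by (intro cong_diff) (simp_all add: cong_int_iff)
  then show ?thesis by (simp add: cong_int_iff)
qed

text \<open>\<open>\<delta>1\<close> and \<open>\<delta>2\<close> are the largest and second largest coset leaders.\<close>

definition \<delta>1 :: nat where "\<delta>1 = n - q ^ (m - 1)"
definition \<delta>2 :: nat where "\<delta>2 = n - q ^ (m - 1) - q ^ ((m - 1) div 2)"

lemma power_half_less: "q ^ ((m - 1) div 2) < q ^ (m - 1)"
  using q_ge m_ge by (intro power_strict_increasing) auto

lemma three_power_pred: "3 * q ^ (m - 1) \<le> n + 1"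
  unfolding power_m'[symmetric] using q_ge by (intro mult_mono) auto

lemma two_power_pred: "2 * q ^ (m - 1) \<le> n"
  using three_power_pred power_pos[of "m - 1"] by linarith

lemma \<delta>1_add: "\<delta>1 + q ^ (m - 1) = n"
  unfolding \<delta>1_def by (rule le_add_diff_inverse2) (use two_power_pred in simp)

lemma \<delta>2_add: "\<delta>2 + q ^ ((m - 1) div 2) = \<delta>1"
  unfolding \<delta>2_def \<delta>1_def
  by (rule le_add_diff_inverse2) (use two_power_pred power_half_less in simp)

text \<open>As \<open>q * q ^ (m - 1) = n + 1\<close>, the product
  \<open>(q - 1) * q ^ (m - 1)\<close> is \<open>\<delta>1 + 1\<close>. The range in the theorem is
  therefore \<open>\<delta>2 < \<delta> \<le> \<delta>1\<close>.\<close>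

lemma leader_formulas:
  "(q - 1) * q ^ (m - 1) - q ^ ((m - 1) div 2) = \<delta>2 + 1"
  "(q - 1) * q ^ (m - 1) - 1 = \<delta>1"
  using power_m' \<delta>1_add \<delta>2_add by (auto simp: diff_mult_distrib)

section \<open>Large coset elements and the two largest leaders\<close>

text \<open>Write \<open>x\<close> with \<open>m\<close> digits in base \<open>q\<close>:
  multiplication by \<open>q ^ k\<close> moves its leading digit to the top place, and nothing wraps
  around.\<close>

lemma conjugate_top:
  assumes "0 < x" "x < n"
  obtains y k where "[x * q ^ k = y] (mod n)" "q ^ (m - 1) \<le> y" "y < n"
proof -
  obtain s where s: "q ^ s \<le> x" "x < q ^ (s + 1)"
    using ex_power_ivl1[of q x] q_ge assms by auto
  have "q ^ s < q ^ m"
    using s assms n_def by linarith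
  then have "s < m"
    using q_ge by (metis power_less_imp_less_exp less_le_trans one_less_numeral_iff semiring_norm(77))
  define k where "k = m - 1 - s"
  have exps: "s + k = m - 1" "s + 1 + k = m"
    using \<open>s < m\<close> by (auto simp: k_def)
  have "q ^ (m - 1) \<le> x * q ^ k"
    using mult_le_mono1[OF s(1), of "q ^ k"] exps by (simp flip: power_add)
  moreover have "x * q ^ k < n"
  \<comment> \<open>For \<open>k = 0\<close> the estimate of the other case would only give
    \<open>x \<le> n\<close>, so \<open>x < n\<close> is used directly.\<close>
  proof (cases "k = 0")
    case False
    have "(x + 1) * q ^ k \<le> q ^ (s + 1) * q ^ k"
      using s by (intro mult_le_mono1) simp
    also have "\<dots> = n + 1"
      using exps power_m by (metis power_add)
    finally have "x * q ^ k + q ^ k \<le> n + 1" by simp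
    moreover have "q ^ k \<ge> q"
      using False q_ge self_le_power[of q k] by simp
    ultimately show ?thesis using q_ge by linarith
  qed (use assms in simp)
  ultimately show thesis using that[of k "x * q ^ k"] by simp
qed

text \<open>Negated, this says that every nonzero coset other than that of \<open>\<delta>1\<close>
  has an element at most \<open>\<delta>2\<close>. Start from a conjugate with nonzero top digit and
  remove \<open>q ^ (m - 1)\<close>; if the rest \<open>r\<close> is too small, a further shift
  brings the leading digit of \<open>r\<close> to the top.\<close>

lemma conjugate_second:
  assumes "0 < x" "x < n" and not_power: "\<And>k. \<not> [x * q ^ k = 1] (mod n)"
  obtains y k where "[x * q ^ k = y] (mod n)" "q ^ (m - 1) + q ^ ((m - 1) div 2) \<le> y" "y < n"
proof -
  define h where "h = (m - 1) div 2"
  obtain y k where y: "[x * q ^ k = y] (mod n)" "q ^ (m - 1) \<le> y" "y < n"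
    using conjugate_top assms by metis
  define r where "r = y - q ^ (m - 1)"
  have yr: "y = q ^ (m - 1) + r"
    using y r_def by simp
  show thesis
  proof (cases "q ^ h \<le> r")
    case True
    with that y yr h_def show thesis by simp
  next
    case False
    have "r \<noteq> 0"
    proof
      assume "r = 0"
      have "[x * q ^ k * q = y * q] (mod n)"
        using y by (intro cong_mult cong_refl)
      also have "y * q = n + 1"
        using yr \<open>r = 0\<close> power_m' by (simp add: mult.commute)
      also have "[n + 1 = 1] (mod n)"
        by (rule cong_add_modulus)
      finally show False
        using not_power[of "Suc k"] by (simp add: ac_simps)
    qed
    then obtain s where s: "q ^ s \<le> r" "r < q ^ (s + 1)"
      using ex_power_ivl1[of q r] q_ge by auto
    have "q ^ s < q ^ h"
      using s False by linarith
    then have "s < h"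
      using q_ge by (metis power_less_imp_less_exp less_le_trans one_less_numeral_iff semiring_norm(77))
    define l where "l = m - 1 - s"
    have exps: "s + l = m - 1" "s + 1 + l = m" "m - 1 + l = m + (l - 1)" "h \<le> l - 1" "l \<noteq> 0"
      using \<open>s < h\<close> h_def l_def by auto
    \<comment> \<open>Under multiplication by \<open>q ^ l\<close> the summand
      \<open>q ^ (m - 1)\<close> wraps around to \<open>q ^ (l - 1)\<close>, while
      \<open>r * q ^ l\<close> reaches the top place. From \<open>s < h\<close> comes
      \<open>h \<le> l - 1\<close>, so the wrapped summand is large enough.\<close>
    define z where "z = q ^ (l - 1) + r * q ^ l"
    have "y * q ^ l = q ^ m * q ^ (l - 1) + r * q ^ l"
      using exps by (simp add: yr algebra_simps flip: power_add)
    also have "[\<dots> = 1 * q ^ (l - 1) + r * q ^ l] (mod n)"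
      by (intro cong_add cong_mult cong_power_m cong_refl)
    finally have "[y * q ^ l = z] (mod n)"
      by (simp add: z_def)
    moreover have "[x * q ^ k * q ^ l = y * q ^ l] (mod n)"
      using y by (intro cong_mult cong_refl)
    ultimately have "[x * q ^ (k + l) = z] (mod n)"
      by (metis cong_trans power_add mult.assoc)
    moreover have "q ^ (m - 1) + q ^ h \<le> z"
    proof -
      have "q ^ (m - 1) \<le> r * q ^ l"
        using mult_le_mono1[OF s(1), of "q ^ l"] exps by (simp flip: power_add)
      moreover have "q ^ h \<le> q ^ (l - 1)"
        using q_ge exps by (intro power_increasing) auto
      ultimately show ?thesis by (simp add: z_def)
    qed
    moreover have "z < n"
    proof -
      have "(r + 1) * q ^ l \<le> q ^ (s + 1) * q ^ l"
        using s by (intro mult_le_mono1) simp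
      also have "\<dots> = n + 1"
        using exps power_m by (metis power_add)
      finally have "r * q ^ l + q ^ l \<le> n + 1" by simp
      moreover have "q ^ l = q * q ^ (l - 1)"
        using exps by (metis power_eq_if)
      moreover have "q * q ^ (l - 1) \<ge> 3 * q ^ (l - 1)" "q ^ (l - 1) > 0"
        using q_ge by auto
      ultimately show ?thesis unfolding z_def by linarith
    qed
    ultimately show thesis using that h_def by blast
  qed
qed

lemma not_cong_small: "[a = b] (mod n) \<Longrightarrow> a < n \<Longrightarrow> b < n \<Longrightarrow> a = b"
  by (simp add: cong_less_modulus_unique_nat)

text \<open>If \<open>j\<close> is conjugate to 1 and \<open>-j\<close> to some
  \<open>a < \<delta>\<close>, then \<open>n\<close> divides \<open>q ^ l + a\<close>, which is
  positive and less than \<open>q ^ (m - 1) + \<delta>1 = n\<close>. If \<open>j\<close> is not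
  conjugate to 1, \<open>conjugate_second\<close> makes \<open>-j\<close> conjugate to a number at
  most \<open>\<delta>2\<close>.\<close>

lemma complementary_2:
  assumes "\<delta>2 < \<delta>" "\<delta> \<le> \<delta>1"
  shows "complementary \<delta> 2"
  unfolding complementary_def
proof (intro allI impI)
  fix j t :: nat
  assume jt: "n dvd j + t" "\<not> n dvd j"
  show "coset_below 2 j \<longleftrightarrow> \<not> coset_below \<delta> t"
  proof
    assume "coset_below 2 j"
    then obtain i k where i: "1 \<le> i" "i < 2" "[j * q ^ k = i] (mod n)"
      unfolding coset_below_def by blast
    have j1: "[j * q ^ k = 1] (mod n)"
      using i by (cases "i = 1") auto
    show "\<not> coset_below \<delta> t"
    proof
      assume "coset_below \<delta> t"
      then have "coset_below \<delta> (t * q ^ k)"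
        using coset_below_cong_mult[OF _ cong_refl] by simp
      then obtain a l where a: "1 \<le> a" "a < \<delta>" "l < m" "[t * q ^ k * q ^ l = a] (mod n)"
        by (rule coset_below_less)
      have "[j * q ^ k * q ^ l = 1 * q ^ l] (mod n)"
        using j1 by (intro cong_mult cong_refl)
      then have "[j * q ^ k * q ^ l + t * q ^ k * q ^ l = q ^ l + a] (mod n)"
        using a by (intro cong_add) auto
      moreover have "n dvd j * q ^ k * q ^ l + t * q ^ k * q ^ l"
        using jt(1) by (metis distrib_right dvd_mult2)
      ultimately have "n dvd q ^ l + a"
        using cong_dvd_iff by blast
      then have "n \<le> q ^ l + a"
        using a by (intro dvd_imp_le) auto
      moreover have "q ^ l \<le> q ^ (m - 1)"
        using a q_ge by (intro power_increasing) auto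
      ultimately show False
        using a assms \<delta>1_add by linarith
    qed
  next
    assume nt: "\<not> coset_below \<delta> t"
    show "coset_below 2 j"
    proof (rule ccontr)
      assume nj: "\<not> coset_below 2 j"
      define x where "x = j mod n"
      have x: "0 < x" "x < n"
        using jt n_ge by (auto simp: x_def dvd_eq_mod_eq_0)
      have "[x = j] (mod n)"
        by (simp add: x_def cong_def)
      have "\<not> [x * q ^ k = 1] (mod n)" for k
      proof
        assume "[x * q ^ k = 1] (mod n)"
        then have "coset_below 2 x"
          unfolding coset_below_def by (intro exI[of _ 1] exI[of _ k]) auto
        with nj \<open>[x = j] (mod n)\<close> show False
          using coset_below_cong by blast
      qed
      with x obtain y k where y: "[x * q ^ k = y] (mod n)"
          "q ^ (m - 1) + q ^ ((m - 1) div 2) \<le> y" "y < n"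
        using conjugate_second by metis
      have "[j * q ^ k = x * q ^ k] (mod n)"
        using \<open>[x = j] (mod n)\<close> by (intro cong_mult cong_refl) (rule cong_sym)
      then have "[j * q ^ k = y] (mod n)"
        using y cong_trans by blast
      moreover have "n dvd j * q ^ k + t * q ^ k"
        using jt(1) by (metis distrib_right dvd_mult2)
      moreover have "n dvd y + (n - y)"
        using y by simp
      ultimately have "[t * q ^ k = n - y] (mod n)"
        using cong_neg by blast
      moreover have "1 \<le> n - y" "n - y < \<delta>"
        using y assms \<delta>1_add \<delta>2_add by linarith+
      ultimately have "coset_below \<delta> t"
        unfolding coset_below_def by blast
      with nt show False ..
    qed
  qed
qed

lemma complementary_imp_le:
  assumes "complementary \<delta> \<delta>'" "\<delta>' \<ge> 2"
  shows "\<delta> \<le> \<delta>1"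
proof (rule ccontr)
  assume "\<not> \<delta> \<le> \<delta>1"
  have "coset_below \<delta>' 1"
    using assms(2) by (intro coset_belowI[of 1 _ 0]) auto
  \<comment> \<open>The number \<open>\<delta>1 * q\<close> is congruent to -1, so 1 and -1 would be
    covered on both sides.\<close>
  moreover have "coset_below \<delta> (\<delta>1 * q)"
  proof (rule coset_belowI)
    show "1 \<le> \<delta>1"
      using \<delta>2_add power_pos[of "(m - 1) div 2"] by linarith
    show "[\<delta>1 * q ^ 1 = \<delta>1 * q] (mod n)"
      by simp
  qed (use \<open>\<not> \<delta> \<le> \<delta>1\<close> in simp)
  moreover have "n dvd 1 + \<delta>1 * q"
  proof -
    have "1 + \<delta>1 * q + n = \<delta>1 * q + q ^ (m - 1) * q"
      using power_m' by (simp add: ac_simps)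
    also have "\<dots> = n * q"
      using \<delta>1_add by (metis distrib_right)
    finally have "n dvd (1 + \<delta>1 * q) + n" by simp
    then show ?thesis by (metis dvd_add_left_iff dvd_refl)
  qed
  moreover have "\<not> n dvd 1"
    using n_ge by simp
  ultimately show False
    using complementaryD[OF assms(1)] by blast
qed

text \<open>The negative of \<open>\<delta>2\<close> is \<open>x = q ^ (m - 1) + q ^ s\<close>.
  Since \<open>x\<close> bounds its conjugates, \<open>\<delta>2\<close> is least in its
  coset.\<close>

lemma not_coset_below_\<delta>2:
  assumes "\<delta> \<le> \<delta>2"
  shows "\<not> coset_below \<delta> \<delta>2"
proof
  define s where "s = (m - 1) div 2"
  have s: "s < m - 1" "m - 2 - s \<le> s"
    using m_ge by (auto simp: s_def)
  define x where "x = q ^ (m - 1) + q ^ s"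
  assume "coset_below \<delta> \<delta>2"
  then obtain a k where a: "1 \<le> a" "a < \<delta>" "k < m" "[\<delta>2 * q ^ k = a] (mod n)"
    by (rule coset_below_less)
  obtain c where c: "[x * q ^ k = c] (mod n)" "c \<le> x"
  proof (cases "k = 0")
    case True
    with that[of x] show ?thesis by auto
  next
    case False
    have exps: "m - 1 + k = m + (k - 1)"
      using False m_ge by simp
    have top: "[q ^ (m - 1) * q ^ k = q ^ (k - 1)] (mod n)"
    proof -
      have "q ^ (m - 1) * q ^ k = q ^ m * q ^ (k - 1)"
        using exps by (metis power_add)
      also have "[\<dots> = 1 * q ^ (k - 1)] (mod n)"
        by (intro cong_mult cong_power_m cong_refl)
      finally show ?thesis by simp
    qed
    have bot: "[q ^ s * q ^ k = q ^ ((s + k) mod m)] (mod n)"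
      using cong_power_mod[of "s + k"] by (simp add: power_add)
    have "[x * q ^ k = q ^ (k - 1) + q ^ ((s + k) mod m)] (mod n)"
      unfolding x_def distrib_right by (intro cong_add top bot)
    moreover have "q ^ (k - 1) + q ^ ((s + k) mod m) \<le> x"
    \<comment> \<open>Because \<open>k < m\<close>, only the second exponent can be
      \<open>m - 1\<close>. Then \<open>s + k = m - 1\<close>, so the other exponent
      \<open>k - 1 = m - 2 - s\<close> is at most \<open>s\<close>. Otherwise both powers are at
      most \<open>q ^ (m - 2)\<close>.\<close>
    proof (cases "(s + k) mod m = m - 1")
      case True
      have "s + k = m - 1"
      proof (cases "s + k < m")
        case False
        then have "(s + k) mod m = s + k - m"
          using a s by (simp add: mod_if)
        with True False a s show ?thesis by simp
      qed (use True in simp)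
      then have "q ^ (k - 1) \<le> q ^ s"
        using s q_ge by (intro power_increasing) auto
      with True show ?thesis by (simp add: x_def)
    next
      case False
      have "(s + k) mod m < m" using m_ge by simp
      with False have "(s + k) mod m \<le> m - 2" by linarith
      then have "q ^ ((s + k) mod m) \<le> q ^ (m - 2)" "q ^ (k - 1) \<le> q ^ (m - 2)"
        using a q_ge by (auto intro!: power_increasing)
      moreover have "q ^ (m - 1) = q * q ^ (m - 2)"
      proof -
        have "m - 1 = Suc (m - 2)"
          using m_ge by simp
        then show ?thesis by (simp only: power_Suc)
      qed
      moreover have "q * q ^ (m - 2) \<ge> 3 * q ^ (m - 2)"
        using q_ge by simp
      ultimately show ?thesis unfolding x_def by linarith
    qed
    ultimately show ?thesis by (rule that)
  qed
  have "[\<delta>2 * q ^ k + x * q ^ k = a + c] (mod n)"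
    using a c by (intro cong_add)
  moreover have "\<delta>2 + x = n"
    using \<delta>1_add \<delta>2_add by (simp add: x_def s_def)
  then have "n dvd \<delta>2 * q ^ k + x * q ^ k"
    by (metis distrib_right dvd_triv_left)
  ultimately have "n dvd a + c"
    using cong_dvd_iff by blast
  then have "n \<le> a + c"
    using a by (intro dvd_imp_le) auto
  with c \<open>\<delta>2 + x = n\<close> a assms show False by linarith
qed

section \<open>Excluding the remaining designed distances\<close>

text \<open>A larger \<open>\<delta>\<close> would force \<open>\<delta>' \<le> q - 1\<close>. But
  the negative of the leader \<open>\<delta>2\<close> has two separated nonzero digits when written
  in base \<open>q\<close>, so it is no shift of a single digit below \<open>q - 1\<close>.\<close>

lemma complementary_imp_less_power:
  assumes compl: "complementary \<delta> \<delta>'" and "\<delta> \<le> \<delta>2"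
  shows "\<delta> < q ^ (m - 1)"
proof (rule ccontr)
  assume "\<not> \<delta> < q ^ (m - 1)"
  define s where "s = (m - 1) div 2"
  have "s < m - 1"
    using m_ge by (auto simp: s_def)
  \<comment> \<open>This element is \<open>q ^ m - q\<close>, the negative of
    \<open>q - 1\<close>.\<close>
  have "coset_below \<delta> ((q ^ (m - 1) - 1) * q)"
    using power_pred_ge q_ge \<open>\<not> \<delta> < q ^ (m - 1)\<close>
    by (intro coset_belowI[of "q ^ (m - 1) - 1" _ 1]) auto
  moreover have "n dvd (q - 1) + (q ^ (m - 1) - 1) * q"
  proof -
    have "(q - 1) + (q ^ (m - 1) - 1) * q = n"
    proof -
      have "q + (q ^ (m - 1) - 1) * q = q ^ (m - 1) * q"
        using power_pos[of "m - 1"] by (cases "q ^ (m - 1)") simp_all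
      then show ?thesis
        using power_m' q_ge by (simp add: mult.commute)
    qed
    then show ?thesis by simp
  qed
  moreover have "\<not> n dvd q - 1"
  proof -
    have "q - 1 < n" using three_power_pred power_pred_ge q_ge by linarith
    then show ?thesis using q_ge by (auto dest: dvd_imp_le)
  qed
  ultimately have "\<not> coset_below \<delta>' (q - 1)"
    using complementaryD[OF compl] by blast
  moreover have "1 \<le> q - 1"
    using q_ge by linarith
  ultimately have "\<delta>' \<le> q - 1"
    using coset_belowI[of "q - 1" \<delta>' 0 "q - 1"] \<open>1 \<le> q - 1\<close> by (cases "q - 1 < \<delta>'") auto
  define x where "x = q ^ (m - 1) + q ^ s"
  have x: "\<delta>2 + x = n" "0 < x" "x < n"
    unfolding x_def s_def
    using \<delta>1_add \<delta>2_add power_half_less three_power_pred power_pred_ge q_ge by linarith+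
  have "coset_below \<delta>' x"
  proof -
    have "n dvd x + \<delta>2" "\<not> n dvd x"
      using x by (auto simp: add.commute dest: dvd_imp_le)
    with complementaryD[OF compl] not_coset_below_\<delta>2[OF assms(2)] show ?thesis by blast
  qed
  then obtain j k where j: "1 \<le> j" "j < \<delta>'" "k < m" "[j * q ^ k = x] (mod n)"
    by (rule coset_below_greater)
  \<comment> \<open>Without wraparound the congruence becomes an equality of naturals, to which
    divisibility by \<open>q ^ (s + 1)\<close> applies.\<close>
  have "j * q ^ k < n"
  proof -
    have "(j + 1) * q ^ k \<le> (q - 1) * q ^ (m - 1)"
      using j \<open>\<delta>' \<le> q - 1\<close> q_ge by (intro mult_mono power_increasing) auto
    also have "\<dots> < n"
      using \<delta>1_add power_m' power_pred_ge q_ge by (simp add: diff_mult_distrib)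
    finally show ?thesis by simp
  qed
  then have eq: "j * q ^ k = x"
    using j x not_cong_small by blast
  have "k \<le> s"
  proof (rule ccontr)
    assume "\<not> k \<le> s"
    then have "q ^ (s + 1) dvd x"
      using eq by (metis Suc_eq_plus1 dvd_mult le_imp_power_dvd not_less_eq_eq)
    moreover have "q ^ (s + 1) dvd q ^ (m - 1)"
      using \<open>s < m - 1\<close> by (intro le_imp_power_dvd) simp
    ultimately have "q ^ (s + 1) dvd q ^ s"
      unfolding x_def using dvd_add_right_iff by blast
    then have "q ^ (s + 1) \<le> q ^ s"
      using q_ge by (intro dvd_imp_le) auto
    then show False using q_ge by simp
  qed
  have "q ^ (m - 1) \<ge> q * q ^ k"
    using \<open>k \<le> s\<close> \<open>s < m - 1\<close> q_ge power_increasing[of "Suc k" "m - 1" q] by simp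
  moreover have "j * q ^ k \<le> q * q ^ k"
    using j \<open>\<delta>' \<le> q - 1\<close> by (intro mult_le_mono1) simp
  moreover have "q ^ s > 0" by (rule power_pos)
  ultimately show False
    using eq unfolding x_def by linarith
qed

text \<open>An element fixed by multiplication by \<open>q\<close> is alone in its coset, so it is
  its own leader.\<close>

lemma fixed_coset_below:
  assumes "[u * q = u] (mod n)" "u < n" "\<delta> \<le> n" "coset_below \<delta> u"
  shows "u < \<delta>"
proof -
  have "[u * q ^ k = u] (mod n)" for k
  proof (induction k)
    case (Suc k)
    have "u * q ^ Suc k = u * q ^ k * q" by simp
    also have "[\<dots> = u * q] (mod n)" by (intro cong_mult Suc cong_refl)
    also note assms(1)
    finally show ?case .
  qed simp
  moreover obtain i k where "1 \<le> i" "i < \<delta>" "[u * q ^ k = i] (mod n)"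
    using assms(4) unfolding coset_below_def by blast
  ultimately have "[u = i] (mod n)" "i < n" "i < \<delta>"
    using assms(3) by (meson cong_sym cong_trans, auto)
  with not_cong_small[of u i] assms(2) show ?thesis by simp
qed

lemma complementary_imp_ge:
  assumes compl: "complementary \<delta> \<delta>'" and "\<delta> \<ge> 3"
  shows "\<delta> > \<delta>2"
proof (rule ccontr)
  assume "\<not> \<delta> > \<delta>2"
  then have \<delta>: "\<delta> < q ^ (m - 1)"
    using complementary_imp_less_power[OF compl] by simp
  have "\<delta>' \<le> \<delta>2"
  proof -
    \<comment> \<open>Chosen so that \<open>w * q\<close> is congruent to -2. As 2 lies below
      \<open>\<delta>\<close>, this gives \<open>\<delta>' \<le> w\<close>, and the bound on
      \<open>\<delta>\<close> becomes available for \<open>\<delta>'\<close> too.\<close>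
    define w where "w = (q - 2) * q ^ (m - 1) - 1"
    have "coset_below \<delta> 2"
      using assms(2) by (intro coset_belowI[of 2 _ 0]) auto
    have le: "q ^ (m - 1) \<le> (q - 2) * q ^ (m - 1)"
      using q_ge by simp
    have w: "w + 2 * q ^ (m - 1) = n"
      using power_m' power_pred_ge q_ge le by (simp add: w_def diff_mult_distrib)
    have "n dvd w * q + 2"
    proof -
      have "w * q + 2 * n + 2 = n * q"
      proof -
        have "n * q = w * q + 2 * (q * q ^ (m - 1))"
          by (subst w[symmetric]) (simp add: algebra_simps)
        then show ?thesis unfolding power_m' by simp
      qed
      then have "n dvd w * q + 2 + 2 * n" by (simp add: ac_simps)
      then show ?thesis by (metis dvd_add_left_iff dvd_triv_right)
    qed
    moreover have "\<not> n dvd w * q"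
    proof
      assume "n dvd w * q"
      with \<open>n dvd w * q + 2\<close> have "n dvd 2" using dvd_add_right_iff by blast
      with n_ge show False by (auto dest: dvd_imp_le)
    qed
    ultimately have "\<not> coset_below \<delta>' (w * q)"
      using complementaryD[OF compl] \<open>coset_below \<delta> 2\<close> by blast
    moreover have "1 \<le> w"
      using le power_pred_ge q_ge unfolding w_def by linarith
    ultimately have "\<delta>' \<le> w"
      using coset_belowI[of w \<delta>' 1 "w * q"] by fastforce
    with w \<delta>1_add \<delta>2_add power_half_less show ?thesis by linarith
  qed
  then have \<delta>': "\<delta>' < q ^ (m - 1)"
    using complementary_imp_less_power[OF complementary_sym[OF compl]] by simp
  \<comment> \<open>All \<open>m\<close> base \<open>q\<close> digits of \<open>u\<close> are 1, so
    multiplication by \<open>q\<close> fixes \<open>u\<close>, and also its negative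
    \<open>(q - 2) * u\<close>. Both are at least \<open>q ^ (m - 1)\<close>, hence covered by
    neither side.\<close>
  define u where "u = (\<Sum>i<m. q ^ i)"
  have u: "(q - 1) * u = n"
  proof -
    have "int ((q - 1) * u) = int q ^ m - 1"
      using power_diff_1_eq[of "int q" m] q_ge by (simp add: u_def of_nat_diff)
    also have "\<dots> = int n"
      using arg_cong[OF power_m, of int] by simp
    finally show ?thesis by (simp only: of_nat_eq_iff)
  qed
  have u': "(q - 2) * u + u = n"
  proof -
    have "q - 1 = (q - 2) + 1" using q_ge by simp
    with u show ?thesis by (metis add_mult_distrib mult_1)
  qed
  have u_ge: "u \<ge> q ^ (m - 1)"
    unfolding u_def using m_ge by (intro member_le_sum) auto
  have u_le: "u \<le> (q - 2) * u"
    using mult_le_mono1[of 1 "q - 2" u] q_ge by linarith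
  have lt: "u < n" "(q - 2) * u < n"
    using u' u_le u_ge power_pos[of "m - 1"] by linarith+
  have fixed: "[u * q = u] (mod n)"
  proof -
    have "u * q = u + n"
      unfolding u[symmetric] using q_ge by (cases q) (simp_all add: mult.commute)
    then show ?thesis using cong_add_modulus[of u] by (simp add: add.commute)
  qed
  have fixed': "[(q - 2) * u * q = (q - 2) * u] (mod n)"
    unfolding mult.assoc by (intro cong_mult fixed cong_refl)
  have le: "\<delta> \<le> n" "\<delta>' \<le> n"
    using \<delta> \<delta>' \<delta>1_add by linarith+
  have "\<not> coset_below \<delta>' ((q - 2) * u)" "\<not> coset_below \<delta> u"
    using fixed_coset_below[OF fixed' lt(2) le(2)] fixed_coset_below[OF fixed lt(1) le(1)]
      u_ge u_le \<delta> \<delta>' by linarith+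
  moreover have "\<not> n dvd (q - 2) * u"
  proof -
    have "0 < (q - 2) * u"
      using u_le u_ge power_pos[of "m - 1"] by linarith
    with lt(2) show ?thesis
      using dvd_imp_le not_le by blast
  qed
  ultimately show False
    using complementaryD[OF compl, of "(q - 2) * u" u] u' by simp
qed

lemma ex_complementary_iff:
  assumes "2 \<le> \<delta>"
  shows "(\<exists>\<delta>'. 2 \<le> \<delta>' \<and> \<delta>' \<le> n \<and> complementary \<delta> \<delta>') \<longleftrightarrow> \<delta> = 2 \<or> (\<delta>2 < \<delta> \<and> \<delta> \<le> \<delta>1)"
proof
  assume "\<exists>\<delta>'. 2 \<le> \<delta>' \<and> \<delta>' \<le> n \<and> complementary \<delta> \<delta>'"
  then obtain \<delta>' where "2 \<le> \<delta>'" "complementary \<delta> \<delta>'" by blast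
  then show "\<delta> = 2 \<or> (\<delta>2 < \<delta> \<and> \<delta> \<le> \<delta>1)"
    using complementary_imp_le complementary_imp_ge[of \<delta> \<delta>'] assms by (cases "\<delta> = 2") auto
next
  assume "\<delta> = 2 \<or> (\<delta>2 < \<delta> \<and> \<delta> \<le> \<delta>1)"
  then show "\<exists>\<delta>'. 2 \<le> \<delta>' \<and> \<delta>' \<le> n \<and> complementary \<delta> \<delta>'"
  proof
    \<comment> \<open>By symmetry, \<open>\<delta>1\<close> serves as the other designed
      distance.\<close>
    assume "\<delta> = 2"
    have "\<delta>2 < \<delta>1"
      using \<delta>2_add power_pos[of "(m - 1) div 2"] by linarith
    then have "complementary 2 \<delta>1"
      by (intro complementary_sym[OF complementary_2]) auto
    moreover have "2 \<le> \<delta>1" "\<delta>1 \<le> n"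
      using \<delta>1_add three_power_pred power_pred_ge q_ge by linarith+
    ultimately show ?thesis using \<open>\<delta> = 2\<close> by blast
  next
    assume "\<delta>2 < \<delta> \<and> \<delta> \<le> \<delta>1"
    with complementary_2 n_ge show ?thesis by (intro exI[of _ 2]) auto
  qed
qed

end

subsection \<open>Codes with prescribed zeros\<close>

text \<open>Multiplication by \<open>x \<noteq> 0\<close> permutes the nonzero elements; cancelling
  their product leaves \<open>x ^ (CARD('c) - 1) = 1\<close>.\<close>

lemma power_card_eq_self:
  fixes x :: "'c::{finite,field}"
  shows "x ^ CARD('c) = x"
proof (cases "x = 0")
  case False
  have "(\<Prod>y\<in>UNIV - {0}. x * y) = \<Prod>(UNIV - {0})"
    by (rule prod.reindex_bij_witness[of _ "\<lambda>y. y / x" "\<lambda>y. x * y"]) (use False in auto)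
  then have "x ^ (CARD('c) - 1) * \<Prod>(UNIV - {0::'c}) = \<Prod>(UNIV - {0})"
    by (simp add: prod.distrib)
  then have "x ^ (CARD('c) - 1) = 1"
    by simp
  moreover have "CARD('c) = Suc (CARD('c) - 1)"
    using finite_UNIV_card_ge_0[where ?'a = 'c] by simp
  ultimately show ?thesis
    by (metis mult.right_neutral power_Suc)
qed (simp add: finite_UNIV_card_ge_0)

text \<open>
  The polynomial \<open>(X + 1)\<^sup>q - X\<^sup>q - 1\<close> has degree less than \<open>q\<close> and vanishes on the whole field
  with \<open>q\<close> elements. This gives the Frobenius endomorphism without knowing that \<open>q\<close> is a
  power of the characteristic.
\<close>

lemma of_nat_binomial_card_eq_0:
  assumes "0 < i" "i < CARD('c::{finite,field})"
  shows "of_nat (CARD('c) choose i) = (0::'c)"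
proof -
  let ?q = "CARD('c)"
  define p :: "'c poly" where "p = (\<Sum>i\<in>{1..<?q}. monom (of_nat (?q choose i)) i)"
  have "poly p x = 0" for x
  proof -
    have "{..?q} = insert 0 (insert ?q {1..<?q})"
      using assms by auto
    then have "(x + 1) ^ ?q = 1 + (x ^ ?q + poly p x)"
      using assms by (simp add: binomial_ring p_def poly_sum poly_monom)
    then show ?thesis
      by (simp add: power_card_eq_self)
  qed
  moreover have "degree p < ?q"
  proof -
    have "degree p \<le> ?q - 1"
      unfolding p_def by (intro degree_sum_le) (auto intro: order.trans[OF degree_monom_le])
    with assms show ?thesis by linarith
  qed
  ultimately have "p = 0"
    using assms by (intro poly_eqI_degree[of UNIV]) auto
  moreover have "coeff p i = of_nat (?q choose i)"
    using assms by (simp add: p_def coeff_sum)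
  ultimately show ?thesis by simp
qed

lemma poly_map_poly_Poly:
  assumes "field_hom h"
  shows "poly (map_poly h (Poly xs)) x = (\<Sum>i<length xs. h (xs ! i) * x ^ i)"
proof -
  interpret field_hom h by fact
  show ?thesis
  proof (induction xs)
    case (Cons a xs)
    then show ?case
      by (simp add: hom_distribs sum.lessThan_Suc_shift sum_distrib_left mult_ac del: sum.lessThan_Suc)
  qed simp
qed

text \<open>As \<open>g\<close> divides the modulus, reduction does not affect divisibility by
  \<open>g\<close>.\<close>

lemma mem_cyclic_code_iff:
  assumes "g dvd monom 1 n - 1"
  shows "c \<in> cyclic_code n g \<longleftrightarrow> c \<in> carrier_vec n \<and> g dvd Poly (list_of_vec c)"
proof -
  have "(\<exists>f. [P = f * g] (mod (monom 1 n - 1))) \<longleftrightarrow> g dvd P" for P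
  proof
    assume "\<exists>f. [P = f * g] (mod (monom 1 n - 1))"
    then obtain f where "[P = f * g] (mod (monom 1 n - 1))" by blast
    then have "[P = f * g] (mod g)"
      using assms by (metis cong_iff_dvd_diff dvd_trans)
    then show "g dvd P"
      by (metis cong_dvd_iff dvd_triv_right cong_def mod_mult_self2_is_0 dvd_eq_mod_eq_0)
  next
    assume "g dvd P"
    then obtain f where "P = f * g"
      by (metis dvd_def mult.commute)
    then show "\<exists>f. [P = f * g] (mod (monom 1 n - 1))"
      using cong_refl by blast
  qed
  then show ?thesis by (simp add: cyclic_code_def)
qed

locale bch_field = field_hom h + power_minus_one q m n
  for h :: "'a::{finite,field_gcd} \<Rightarrow> 'b::{finite,field}" and q m n +
  fixes \<alpha> :: 'b
  assumes card_base: "CARD('a) = q"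
    and card_ext: "CARD('b) = q ^ m"
    and powers_\<alpha>: "range (\<lambda>k::nat. \<alpha> ^ k) = UNIV - {0}"
begin

sublocale poly_hom: map_poly_comm_ring_hom h ..

lemma frobenius_add: "(x + y) ^ q = x ^ q + (y :: 'b) ^ q"
proof -
  \<comment> \<open>The extension has \<open>q ^ m\<close> elements, so the binomial coefficients
    are shown to vanish in the base field and carried over by \<open>h\<close>.\<close>
  have zero: "of_nat (q choose i) = (0::'b)" if "0 < i" "i < q" for i
    using of_nat_binomial_card_eq_0[of i, where 'c = 'a] that
    by (metis card_base hom_of_nat hom_zero)
  have "(x + y) ^ q = (\<Sum>i\<le>q. of_nat (q choose i) * x ^ i * y ^ (q - i))"
    by (rule binomial_ring)
  also have "\<dots> = (\<Sum>i\<in>{0,q}. of_nat (q choose i) * x ^ i * y ^ (q - i))"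
    by (rule sum.mono_neutral_right) (auto simp: zero)
  also have "\<dots> = x ^ q + y ^ q"
    using q_ge by simp
  finally show ?thesis .
qed

lemma frobenius_power_add: "(x + y) ^ (q ^ k) = x ^ (q ^ k) + (y :: 'b) ^ (q ^ k)"
  by (induction k) (simp_all add: power_mult frobenius_add mult.commute[of q])

lemma frobenius_power_sum: "(\<Sum>i\<in>A. f i) ^ (q ^ k) = (\<Sum>i\<in>A. (f i :: 'b) ^ (q ^ k))"
  by (induction A rule: infinite_finite_induct)
     (use power_pos[of k] in \<open>simp_all add: frobenius_power_add power_0_left\<close>)

lemma hom_power_q: "h c ^ (q ^ k) = h c"
proof (induction k)
  case (Suc k)
  have "h c ^ (q ^ Suc k) = (h c ^ (q ^ k)) ^ q"
    by (simp add: power_mult mult.commute[of q])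
  with Suc show ?case
    using power_card_eq_self[of c] card_base by (simp flip: hom_power)
qed simp

text \<open>The field has \<open>q = 0\<close>. The factor \<open>n\<close> in the orthogonality
  relations is thus a mere sign.\<close>

lemma of_nat_n: "of_nat n = (-1 :: 'b)"
proof -
  have "of_nat q = (0 :: 'b)"
  proof -
    have "of_nat q = (0 :: 'a)"
      using of_nat_binomial_card_eq_0[of 1, where 'c = 'a] q_ge unfolding card_base by simp
    then show ?thesis
      by (metis hom_of_nat hom_zero)
  qed
  then have "of_nat (q ^ m) = (0 :: 'b)"
    using m_ge by (simp add: power_0_left)
  then show ?thesis
    unfolding power_m by (simp add: eq_neg_iff_add_eq_0 add.commute)
qed

lemma \<alpha>_nonzero: "\<alpha> \<noteq> 0"
proof -
  have "\<alpha> ^ 1 \<in> UNIV - {0}"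
    unfolding powers_\<alpha>[symmetric] by blast
  then show ?thesis by simp
qed

lemma power_ext: "x ^ (q ^ m) = (x :: 'b)"
  using power_card_eq_self[of x] card_ext by simp

lemma \<alpha>_power_n: "\<alpha> ^ n = 1"
  using power_ext[of \<alpha>] \<alpha>_nonzero by (simp add: power_m)

lemma \<alpha>_power_mod: "\<alpha> ^ (t mod n) = \<alpha> ^ t"
proof -
  have "\<alpha> ^ t = (\<alpha> ^ n) ^ (t div n) * \<alpha> ^ (t mod n)"
    by (simp flip: power_mult power_add)
  then show ?thesis by (simp add: \<alpha>_power_n)
qed

text \<open>A period \<open>r < n\<close> would leave at most \<open>r\<close> powers of
  \<open>\<alpha>\<close>, fewer than the \<open>n\<close> nonzero elements.\<close>

lemma \<alpha>_power_eq_1_iff: "\<alpha> ^ t = 1 \<longleftrightarrow> n dvd t"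
proof
  assume "n dvd t"
  then show "\<alpha> ^ t = 1"
    by (auto simp: dvd_def power_mult \<alpha>_power_n)
next
  assume "\<alpha> ^ t = 1"
  define r where "r = t mod n"
  have r: "\<alpha> ^ r = 1" "r < n"
    using \<open>\<alpha> ^ t = 1\<close> n_ge by (simp_all add: r_def \<alpha>_power_mod)
  show "n dvd t"
  proof (rule ccontr)
    assume "\<not> n dvd t"
    then have "r > 0"
      by (simp add: r_def dvd_eq_mod_eq_0)
    have "\<alpha> ^ k = \<alpha> ^ (k mod r)" for k
    proof -
      have "\<alpha> ^ k = (\<alpha> ^ r) ^ (k div r) * \<alpha> ^ (k mod r)"
        by (simp flip: power_mult power_add)
      then show ?thesis by (simp add: r)
    qed
    then have "UNIV - {0} \<subseteq> (\<lambda>k. \<alpha> ^ k) ` {..<r}"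
      unfolding powers_\<alpha>[symmetric] using \<open>r > 0\<close> by (metis image_subsetI imageI lessThan_iff mod_less_divisor)
    then have "card (UNIV - {0::'b}) \<le> card {..<r}"
      by (rule surj_card_le[rotated]) simp
    moreover have "card (UNIV - {0::'b}) = n"
      using card_ext by (simp add: n_def card_Diff_singleton)
    ultimately show False using r by simp
  qed
qed

lemma sum_\<alpha>_powers: "(\<Sum>i<n. \<alpha> ^ (i * t)) = (if n dvd t then -1 else 0)"
proof (cases "n dvd t")
  case True
  then have "\<alpha> ^ (i * t) = 1" for i
    by (simp add: \<alpha>_power_eq_1_iff)
  with True show ?thesis by (simp add: of_nat_n)
next
  case False
  have "(\<alpha> ^ t - 1) * (\<Sum>i<n. (\<alpha> ^ t) ^ i) = (\<alpha> ^ t) ^ n - 1"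
    by (rule power_diff_1_eq[symmetric])
  also have "\<dots> = 0"
    by (simp add: \<alpha>_power_n power_mult[symmetric] mult.commute[of t]) (simp add: power_mult \<alpha>_power_n)
  finally have "(\<Sum>i<n. (\<alpha> ^ t) ^ i) = 0"
    using False by (simp add: \<alpha>_power_eq_1_iff)
  with False show ?thesis
    by (simp add: mult.commute[of _ t] power_mult)
qed

section \<open>Fourier transform and trace words\<close>

text \<open>The discrete Fourier transform of \<open>c\<close>: its polynomial evaluated at
  \<open>\<alpha> ^ j\<close>.\<close>

definition ev :: "'a vec \<Rightarrow> nat \<Rightarrow> 'b" where
  "ev c j = (\<Sum>i<n. h (c $ i) * \<alpha> ^ (i * j))"

lemma ev_cong: "[s = t] (mod n) \<Longrightarrow> ev c s = ev c t"
  unfolding ev_def by (metis (no_types, lifting) \<alpha>_power_mod cong_def mod_mult_right_eq)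

text \<open>Frobenius fixes the coefficients, which come from the base field. Hence zeros come in
  whole cosets.\<close>

lemma ev_mult_power: "ev c (t * q ^ k) = ev c t ^ (q ^ k)"
  by (simp add: ev_def frobenius_power_sum power_mult_distrib hom_power_q mult.assoc flip: power_mult)

definition tr :: "'b \<Rightarrow> 'b" where
  "tr x = (\<Sum>k<m. x ^ (q ^ k))"

text \<open>The polynomial \<open>X ^ q - X\<close> has at most \<open>q\<close> roots, and
  \<open>range h\<close> already supplies \<open>q\<close> of them.\<close>

lemma fixed_in_range:
  assumes "x ^ q = x"
  shows "x \<in> range h"
proof -
  let ?p = "monom 1 q - [:0, 1:] :: 'b poly"
  let ?Z = "{x. poly ?p x = 0}"
  have Z: "?Z = {x. x ^ q = x}"
    by (simp add: poly_monom)
  have coeff: "coeff ?p q = 1"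
    using q_ge by (simp add: coeff_pCons split: nat.split)
  have "degree ?p \<le> q"
    using q_ge by (intro degree_diff_le) (auto simp: degree_monom_eq)
  moreover have "?p \<noteq> 0"
    using coeff by (metis coeff_0 zero_neq_one)
  ultimately have "card ?Z \<le> q"
    using card_poly_roots_bound[of ?p] by linarith
  moreover have "card (range h) = q"
    using card_base by (simp add: card_image inj_f)
  moreover have "range h \<subseteq> ?Z"
    using hom_power_q[of _ 1] unfolding Z by auto
  ultimately have "range h = ?Z"
    by (intro card_seteq) auto
  with assms Z show ?thesis by simp
qed

text \<open>Frobenius permutes the summands cyclically, since
  \<open>x ^ (q ^ m) = x\<close>.\<close>

lemma tr_in_range: "tr x \<in> range h"
proof (rule fixed_in_range)
  let ?f = "\<lambda>k. x ^ (q ^ k)"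
  have "tr x ^ q = (\<Sum>k<m. ?f (Suc k))"
    using frobenius_power_sum[of ?f "{..<m}" 1]
    by (simp only: tr_def power_Suc2 power_mult power_0 mult_1 power_one_right)
  moreover have "?f 0 + (\<Sum>k<m. ?f (Suc k)) = (\<Sum>k<m. ?f k) + ?f m"
    by (rule trans[OF sum.lessThan_Suc_shift[symmetric] sum.lessThan_Suc])
  ultimately show "tr x ^ q = tr x"
    by (simp add: tr_def power_ext add.commute)
qed

text \<open>The degree is at most \<open>q ^ (m - 1)\<close>, too small to vanish on all
  \<open>q ^ m\<close> elements. Arbitrary \<open>K\<close> is allowed because short cosets lead to
  partial traces.\<close>

lemma ex_sum_powers_nonzero:
  assumes "K \<subseteq> {..<m}" "K \<noteq> {}"
  obtains x :: 'b where "(\<Sum>k\<in>K. x ^ (q ^ k)) \<noteq> 0"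
proof -
  define p :: "'b poly" where "p = (\<Sum>k\<in>K. monom 1 (q ^ k))"
  have "finite K"
    using assms finite_subset by blast
  obtain l where "l \<in> K"
    using assms by blast
  have inj: "q ^ k = q ^ l \<longleftrightarrow> k = l" for k
    using q_ge by simp
  have "coeff p (q ^ l) = 1"
    using \<open>l \<in> K\<close> \<open>finite K\<close> by (simp add: p_def coeff_sum inj)
  then have "p \<noteq> 0" by auto
  have "degree p \<le> q ^ (m - 1)"
    unfolding p_def
  proof (intro degree_sum_le \<open>finite K\<close>)
    fix k assume "k \<in> K"
    then have "k \<le> m - 1" using assms by auto
    then show "degree (monom 1 (q ^ k) :: 'b poly) \<le> q ^ (m - 1)"
      using q_ge by (simp add: degree_monom_eq power_increasing)
  qed
  also have "\<dots> < q ^ m"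
    using q_ge m_ge by (intro power_strict_increasing) auto
  finally have "degree p < CARD('b)"
    by (simp add: card_ext)
  have "\<exists>x. poly p x \<noteq> 0"
  proof (rule ccontr)
    assume "\<not> ?thesis"
    then have "CARD('b) \<le> degree p"
      using card_poly_roots_bound[OF \<open>p \<noteq> 0\<close>] by simp
    with \<open>degree p < CARD('b)\<close> show False by simp
  qed
  with that show thesis
    by (auto simp: p_def poly_sum poly_monom)
qed

lemma ex_tr_nonzero: obtains x where "tr x \<noteq> 0"
proof -
  have "{..<m} \<noteq> {}"
    using m_ge by (simp add: lessThan_empty_iff)
  from ex_sum_powers_nonzero[OF subset_refl this] that show thesis
    unfolding tr_def by blast
qed

text \<open>The trace has values in \<open>'b\<close>; \<open>inv_into\<close> pulls them back to
  the base field.\<close>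

definition trace_word :: "'b \<Rightarrow> nat \<Rightarrow> 'a vec" where
  "trace_word x j = vec n (\<lambda>i. inv_into UNIV h (tr (x * \<alpha> ^ (i * j))))"

lemma trace_word_carrier: "trace_word x j \<in> carrier_vec n"
  by (simp add: trace_word_def)

lemma hom_trace_word: "i < n \<Longrightarrow> h (trace_word x j $ i) = tr (x * \<alpha> ^ (i * j))"
  by (simp add: trace_word_def f_inv_into_f tr_in_range)

text \<open>Expanding the trace and applying orthogonality shows that the transform is supported on
  the negative of the coset of \<open>j\<close>.\<close>

lemma ev_trace_word: "ev (trace_word x j) t = - (\<Sum>k | k < m \<and> n dvd j * q ^ k + t. x ^ (q ^ k))"
proof -
  have "ev (trace_word x j) t = (\<Sum>i<n. \<Sum>k<m. x ^ (q ^ k) * \<alpha> ^ (i * (j * q ^ k + t)))"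
    unfolding ev_def
    by (intro sum.cong refl)
       (simp add: hom_trace_word tr_def sum_distrib_right power_mult_distrib power_add distrib_left
         mult.assoc flip: power_mult)
  also have "\<dots> = (\<Sum>k<m. x ^ (q ^ k) * (\<Sum>i<n. \<alpha> ^ (i * (j * q ^ k + t))))"
    by (subst sum.swap) (simp add: sum_distrib_left)
  also have "\<dots> = (\<Sum>k<m. if n dvd j * q ^ k + t then - (x ^ (q ^ k)) else 0)"
    by (intro sum.cong) (simp_all add: sum_\<alpha>_powers)
  also have "\<dots> = (\<Sum>k | k < m \<and> n dvd j * q ^ k + t. - (x ^ (q ^ k)))"
    by (subst sum.inter_filter[symmetric]) simp_all
  finally show ?thesis by (simp add: sum_negf)
qed

section \<open>Duality of codes with prescribed zeros\<close>

text \<open>The case \<open>k = 0\<close> includes invariance under congruence, so \<open>A\<close>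
  is a union of cosets modulo \<open>n\<close>.\<close>

definition conj_closed :: "(nat \<Rightarrow> bool) \<Rightarrow> bool" where
  "conj_closed A \<longleftrightarrow> (\<forall>j k j'. A j \<longrightarrow> [j * q ^ k = j'] (mod n) \<longrightarrow> A j')"

definition zero_code :: "(nat \<Rightarrow> bool) \<Rightarrow> 'a vec set" where
  "zero_code A = {c \<in> carrier_vec n. \<forall>t. A t \<longrightarrow> ev c t = 0}"

definition dual_zeros :: "(nat \<Rightarrow> bool) \<Rightarrow> nat \<Rightarrow> bool" where
  "dual_zeros A j \<longleftrightarrow> (\<forall>t. n dvd j + t \<longrightarrow> \<not> A t)"

lemma conj_closedD: "conj_closed A \<Longrightarrow> A j \<Longrightarrow> [j * q ^ k = j'] (mod n) \<Longrightarrow> A j'"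
  unfolding conj_closed_def by blast

lemma conj_closed_cong: "conj_closed A \<Longrightarrow> [j = j'] (mod n) \<Longrightarrow> A j \<Longrightarrow> A j'"
  using conj_closedD[of A j 0 j'] by simp

lemma conj_closed_rev:
  assumes "conj_closed A" "A (j * q ^ k)"
  shows "A j"
proof (rule conj_closedD[OF assms])
  have "j * q ^ k * q ^ (k * (m - 1)) = j * (q ^ k * q ^ (k * (m - 1)))"
    by (simp add: mult.assoc)
  also have "[\<dots> = j * 1] (mod n)"
    by (intro cong_mult cong_power_inverse cong_refl)
  finally show "[j * q ^ k * q ^ (k * (m - 1)) = j] (mod n)"
    by simp
qed

text \<open>This makes \<open>j * (n - 1)\<close> a natural number representing
  \<open>-j\<close>.\<close>

lemma dvd_neg: "n dvd j + j * (n - 1)"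
proof -
  have "j + j * (n - 1) = j * n"
    using n_ge by (cases n) auto
  then show ?thesis by simp
qed

lemma dvd_add_mult: "n dvd i + j \<Longrightarrow> n dvd i * k + j * k"
  by (metis distrib_right dvd_mult2)

lemma trace_word_in_zero_code:
  assumes "conj_closed A" "n dvd i + j" "\<not> A j"
  shows "trace_word x i \<in> zero_code A"
proof -
  have "ev (trace_word x i) t = 0" if "A t" for t
  proof -
    have "\<not> n dvd i * q ^ k + t" for k
    proof
      assume "n dvd i * q ^ k + t"
      moreover have "n dvd i * q ^ k + j * q ^ k"
        using assms(2) by (rule dvd_add_mult)
      ultimately have "[t = j * q ^ k] (mod n)"
        using cong_neg[OF _ _ cong_refl] by blast
      then have "A (j * q ^ k)"
        using conj_closed_cong assms(1) that by blast
      with conj_closed_rev assms show False by blast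
    qed
    then show ?thesis by (simp add: ev_trace_word)
  qed
  then show ?thesis
    by (simp add: zero_code_def trace_word_carrier)
qed

text \<open>If \<open>A\<close> misses \<open>j\<close>, it misses the whole coset. A trace word
  supported on that coset lies in the code of \<open>A\<close> and, for suitable \<open>x\<close>,
  has nonzero transform at \<open>j\<close>.\<close>

lemma zero_code_subset_imp:
  assumes "conj_closed A" "zero_code A \<subseteq> zero_code B" "B j"
  shows "A j"
proof (rule ccontr)
  assume "\<not> A j"
  define i where "i = j * (n - 1)"
  have ij: "n dvd i + j"
    using dvd_neg[of j] by (simp add: i_def add.commute)
  \<comment> \<open>\<open>K\<close> contains 0, and further exponents when the coset of
    \<open>j\<close> has fewer than \<open>m\<close> elements.\<close>
  define K where "K = {k. k < m \<and> n dvd i * q ^ k + j}"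
  have "K \<subseteq> {..<m}" "K \<noteq> {}"
    using ij m_ge by (auto simp: K_def intro!: exI[of _ 0])
  then obtain x :: 'b where x: "(\<Sum>k\<in>K. x ^ (q ^ k)) \<noteq> 0"
    by (rule ex_sum_powers_nonzero)
  have "trace_word x i \<in> zero_code B"
    using trace_word_in_zero_code[OF assms(1) ij \<open>\<not> A j\<close>] assms(2) by blast
  then have "ev (trace_word x i) j = 0"
    using assms(3) by (simp add: zero_code_def)
  with x show False by (simp add: ev_trace_word K_def)
qed

lemma zero_code_eq_iff:
  assumes "conj_closed A" "conj_closed B"
  shows "zero_code A = zero_code B \<longleftrightarrow> A = B"
  using zero_code_subset_imp[OF assms(1), of B] zero_code_subset_imp[OF assms(2), of A] by blast

text \<open>Orthogonality over \<open>j\<close> keeps only the terms with \<open>i = l\<close>; the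
  minus sign is the factor \<open>n\<close>.\<close>

lemma parseval:
  assumes "v \<in> carrier_vec n" "c \<in> carrier_vec n"
  shows "(\<Sum>j<n. ev v j * ev c (j * (n - 1))) = - h (v \<bullet> c)"
proof -
  have dvd: "n dvd i + l * (n - 1) \<longleftrightarrow> i = l" if "i < n" "l < n" for i l
  proof
    assume "n dvd i + l * (n - 1)"
    then have "[i = l] (mod n)"
      using cong_neg[of "l * (n - 1)" i "l * (n - 1)" l] dvd_neg[of l] by (simp add: add.commute)
    with that not_cong_small show "i = l" by blast
  qed (use dvd_neg in blast)
  have orth: "(\<Sum>j<n. \<alpha> ^ (j * (i + l * (n - 1)))) = (if i = l then -1 else 0)"
    if "i < n" "l < n" for i l
    by (simp only: sum_\<alpha>_powers dvd that)
  have "(\<Sum>j<n. ev v j * ev c (j * (n - 1))) =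
      (\<Sum>j<n. \<Sum>i<n. \<Sum>l<n. h (v $ i) * h (c $ l) * \<alpha> ^ (j * (i + l * (n - 1))))"
    unfolding ev_def sum_product
    by (intro sum.cong refl) (simp add: power_add distrib_left mult_ac)
  also have "\<dots> = (\<Sum>i<n. \<Sum>j<n. \<Sum>l<n. h (v $ i) * h (c $ l) * \<alpha> ^ (j * (i + l * (n - 1))))"
    by (rule sum.swap)
  also have "\<dots> = (\<Sum>i<n. \<Sum>l<n. \<Sum>j<n. h (v $ i) * h (c $ l) * \<alpha> ^ (j * (i + l * (n - 1))))"
    by (intro sum.cong refl sum.swap)
  also have "\<dots> = (\<Sum>i<n. \<Sum>l<n. h (v $ i) * h (c $ l) * (if i = l then -1 else 0))"
    by (intro sum.cong refl) (simp only: lessThan_iff orth flip: sum_distrib_left)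
  also have "\<dots> = (\<Sum>i<n. \<Sum>l<n. if i = l then - (h (v $ i) * h (c $ l)) else 0)"
    by (intro sum.cong refl) simp
  also have "\<dots> = - (\<Sum>i<n. h (v $ i) * h (c $ i))"
    by (simp add: sum_negf)
  also have "(\<Sum>i<n. h (v $ i) * h (c $ i)) = h (v \<bullet> c)"
    using assms by (simp add: scalar_prod_def hom_sum hom_mult atLeast0LessThan)
  finally show ?thesis .
qed

text \<open>The trace is linear over the base field, so the coefficients of \<open>v\<close> move
  inside it.\<close>

lemma hom_scalar_prod_trace_word:
  assumes "v \<in> carrier_vec n"
  shows "h (v \<bullet> trace_word x j) = tr (x * ev v j)"
proof -
  have "h (v \<bullet> trace_word x j) = (\<Sum>i<n. h (v $ i) * tr (x * \<alpha> ^ (i * j)))"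
    using trace_word_carrier[of x j]
    by (simp add: scalar_prod_def hom_sum hom_mult atLeast0LessThan hom_trace_word)
  also have "\<dots> = (\<Sum>i<n. \<Sum>k<m. (x * (h (v $ i) * \<alpha> ^ (i * j))) ^ (q ^ k))"
    unfolding tr_def sum_distrib_left
    by (intro sum.cong refl) (simp add: power_mult_distrib hom_power_q mult_ac)
  also have "\<dots> = (\<Sum>k<m. \<Sum>i<n. (x * (h (v $ i) * \<alpha> ^ (i * j))) ^ (q ^ k))"
    by (rule sum.swap)
  also have "\<dots> = tr (x * ev v j)"
    by (simp add: tr_def ev_def sum_distrib_left frobenius_power_sum)
  finally show ?thesis .
qed

theorem dual_zero_code:
  assumes "conj_closed A"
  shows "dual_code n (zero_code A) = zero_code (dual_zeros A)"
proof (intro equalityI subsetI)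
  fix v assume "v \<in> zero_code (dual_zeros A)"
  then have v: "v \<in> carrier_vec n" "\<And>j. dual_zeros A j \<Longrightarrow> ev v j = 0"
    by (auto simp: zero_code_def)
  have "v \<bullet> c = 0" if "c \<in> zero_code A" for c
  proof -
    from that have c: "c \<in> carrier_vec n" "\<And>j. A j \<Longrightarrow> ev c j = 0"
      by (auto simp: zero_code_def)
    \<comment> \<open>Either \<open>-j\<close> lies in \<open>A\<close> and the second factor
      vanishes, or \<open>j\<close> is a dual zero and the first does.\<close>
    have "ev v j * ev c (j * (n - 1)) = 0" for j
    proof (cases "A (j * (n - 1))")
      case False
      have "dual_zeros A j"
        unfolding dual_zeros_def
      proof (intro allI impI)
        fix t assume "n dvd j + t"
        then have "[t = j * (n - 1)] (mod n)"
          using cong_neg[OF _ dvd_neg cong_refl] by blast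
        then show "\<not> A t"
          using conj_closed_cong[OF assms] False by blast
      qed
      with v show ?thesis by simp
    qed (use c in simp)
    then have "(\<Sum>j<n. ev v j * ev c (j * (n - 1))) = 0"
      by (intro sum.neutral) blast
    then have "h (v \<bullet> c) = 0"
      unfolding parseval[OF v(1) c(1)] by simp
    then show ?thesis by simp
  qed
  with v show "v \<in> dual_code n (zero_code A)"
    by (simp add: dual_code_def)
next
  fix v assume "v \<in> dual_code n (zero_code A)"
  then have v: "v \<in> carrier_vec n" "\<And>c. c \<in> zero_code A \<Longrightarrow> v \<bullet> c = 0"
    by (auto simp: dual_code_def)
  have "ev v j = 0" if j: "dual_zeros A j" for j
  proof (rule ccontr)
    assume "ev v j \<noteq> 0"
    \<comment> \<open>Scaling the trace word by \<open>y / ev v j\<close> turns its product with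
      \<open>v\<close> into \<open>tr y\<close>.\<close>
    obtain y where y: "tr y \<noteq> 0"
      by (rule ex_tr_nonzero)
    have "\<not> A (j * (n - 1))"
      using j dvd_neg by (simp add: dual_zeros_def)
    then have "v \<bullet> trace_word (y / ev v j) j = 0"
      using v(2) trace_word_in_zero_code[OF assms dvd_neg] by blast
    then have "tr (y / ev v j * ev v j) = 0"
      using hom_scalar_prod_trace_word[OF v(1), of "y / ev v j" j] by simp
    with y \<open>ev v j \<noteq> 0\<close> show False by simp
  qed
  with v show "v \<in> zero_code (dual_zeros A)"
    by (simp add: zero_code_def)
qed

lemma conj_closed_dual_zeros:
  assumes "conj_closed A"
  shows "conj_closed (dual_zeros A)"
  unfolding conj_closed_def dual_zeros_def
proof (intro allI impI)
  fix j k j' t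
  assume j: "\<forall>t. n dvd j + t \<longrightarrow> \<not> A t" and j': "[j * q ^ k = j'] (mod n)" "n dvd j' + t"
  show "\<not> A t"
  proof
    assume "A t"
    have "n dvd j * q ^ k + j * (n - 1) * q ^ k"
      using dvd_neg by (rule dvd_add_mult)
    then have "[j * (n - 1) * q ^ k = t] (mod n)"
      using cong_neg j' by blast
    then have "A (j * (n - 1))"
      using \<open>A t\<close> assms by (metis conj_closed_cong conj_closed_rev cong_sym)
    with j dvd_neg show False by blast
  qed
qed

section \<open>Minimal polynomials and the zeros of BCH codes\<close>

abbreviation vanishes :: "'a poly \<Rightarrow> 'b \<Rightarrow> bool" where
  "vanishes p x \<equiv> poly (map_poly h p) x = 0"

lemma vanishes_diff: "vanishes p x \<Longrightarrow> vanishes r x \<Longrightarrow> vanishes (p - r) x"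
  by (simp add: poly_hom.hom_minus)

lemma vanishes_mult: "vanishes p x \<Longrightarrow> vanishes (p * r) x"
  by (simp add: poly_hom.hom_mult)

text \<open>The description in \<open>min_poly\<close> must first be shown to denote: a nonzero
  annihilator of least degree is made monic, and the difference of two such has smaller degree.
  Division with remainder then gives the equivalence.\<close>

lemma min_poly_dvd_iff: "min_poly h x dvd p \<longleftrightarrow> vanishes p x"
proof -
  let ?min = "\<lambda>p. lead_coeff p = 1 \<and> vanishes p x \<and> (\<forall>r. r \<noteq> 0 \<and> vanishes r x \<longrightarrow> degree p \<le> degree r)"
  have "\<exists>p. p \<noteq> 0 \<and> vanishes p x"
  proof -
    \<comment> \<open>Some annihilator exists, namely \<open>X ^ (q ^ m) - X\<close>; this
      coefficient shows that it is nonzero.\<close>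
    have "coeff (monom 1 (q ^ m) - monom 1 1 :: 'a poly) 1 = -1"
      using power_m n_ge by simp
    moreover have "vanishes (monom 1 (q ^ m) - monom 1 1) x"
      by (simp add: poly_hom.hom_minus poly_monom power_ext)
    ultimately show ?thesis
      by (metis coeff_0 neg_equal_0_iff_equal zero_neq_one)
  qed
  then obtain p0 where p0: "p0 \<noteq> 0" "vanishes p0 x" "\<And>r. r \<noteq> 0 \<Longrightarrow> vanishes r x \<Longrightarrow> degree p0 \<le> degree r"
    using ex_has_least_nat[of "\<lambda>p. p \<noteq> 0 \<and> vanishes p x" _ degree] by blast
  have monic: "?min (smult (inverse (lead_coeff p0)) p0)"
    using p0 by (simp add: hom_distribs)
  have unique: "p = r" if pr: "?min p" "?min r" for p r
  proof (rule ccontr)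
    assume "p \<noteq> r"
    have "degree p = degree r"
      using pr by (metis leading_coeff_0_iff order_antisym zero_neq_one)
    then have "coeff (p - r) (degree p) = 0" "degree (p - r) \<le> degree p"
      using pr by (auto intro: degree_diff_le)
    moreover have "degree p \<le> degree (p - r)"
      using pr \<open>p \<noteq> r\<close> vanishes_diff by auto
    ultimately have "p - r = 0"
      by (metis leading_coeff_0_iff order_antisym)
    with \<open>p \<noteq> r\<close> show False by simp
  qed
  have min: "?min (min_poly h x)"
    unfolding min_poly_def
  proof (rule theI[of ?min, OF monic])
    fix r assume "?min r"
    then show "r = smult (inverse (lead_coeff p0)) p0"
      using monic by (rule unique)
  qed
  show ?thesis
  proof
    assume "min_poly h x dvd p"
    with min vanishes_mult show "vanishes p x"
      by (auto simp: dvd_def)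
  next
    assume "vanishes p x"
    have "p mod min_poly h x = p - min_poly h x * (p div min_poly h x)"
      by (simp add: minus_mult_div_eq_mod)
    then have "vanishes (p mod min_poly h x) x"
      using \<open>vanishes p x\<close> min vanishes_mult vanishes_diff by metis
    moreover have "min_poly h x \<noteq> 0"
      using min by auto
    ultimately have "p mod min_poly h x = 0"
      using min degree_mod_less[of "min_poly h x" p] by (metis not_le)
    then show "min_poly h x dvd p"
      by (simp add: dvd_eq_mod_eq_0)
  qed
qed

lemma vanishes_Poly:
  "c \<in> carrier_vec n \<Longrightarrow> vanishes (Poly (list_of_vec c)) (\<alpha> ^ j) \<longleftrightarrow> ev c j = 0"
  by (simp add: poly_map_poly_Poly[OF field_hom_axioms] ev_def list_of_vec_index mult.commute[of j]
      flip: power_mult cong: sum.cong)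

lemma bch_gen_dvd_iff: "bch_gen h \<alpha> \<delta> dvd p \<longleftrightarrow> (\<forall>j. 1 \<le> j \<longrightarrow> j < \<delta> \<longrightarrow> vanishes p (\<alpha> ^ j))"
  unfolding bch_gen_def Lcm_dvd_iff by (auto simp: min_poly_dvd_iff)

lemma vanishes_x_n_minus_1: "vanishes (monom 1 n - 1) (\<alpha> ^ j)"
  by (simp add: poly_hom.hom_minus poly_monom \<alpha>_power_eq_1_iff flip: power_mult)

lemma bch_gen_dvd_x_n_minus_1: "bch_gen h \<alpha> \<delta> dvd monom 1 n - 1"
  by (simp add: bch_gen_dvd_iff vanishes_x_n_minus_1)

text \<open>The all-one word \<open>w\<close> vanishes at \<open>\<alpha> ^ j\<close> for
  \<open>0 < j < n\<close>, so the generator divides it; but its value at 1 is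
  \<open>n = -1\<close>.\<close>

lemma bch_gen_not_vanishes_1:
  assumes "\<delta> \<le> n"
  shows "poly (bch_gen h \<alpha> \<delta>) 1 \<noteq> 0"
proof
  assume g: "poly (bch_gen h \<alpha> \<delta>) 1 = 0"
  define w :: "'a poly" where "w = Poly (replicate n 1)"
  have w: "poly (map_poly h w) (\<alpha> ^ j) = (\<Sum>i<n. \<alpha> ^ (i * j))" for j
    unfolding w_def poly_map_poly_Poly[OF field_hom_axioms]
    by (rule sum.cong) (simp_all add: mult.commute flip: power_mult)
  have "bch_gen h \<alpha> \<delta> dvd w"
    unfolding bch_gen_dvd_iff w using assms by (auto simp: sum_\<alpha>_powers dest: dvd_imp_le)
  then have "poly w 1 = 0"
    using g by (auto simp: dvd_def)
  then have "poly (map_poly h w) (\<alpha> ^ 0) = 0"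
    by (metis hom_zero poly_map_poly power_0 hom_one)
  then show False
    by (simp only: w sum_\<alpha>_powers) simp
qed

text \<open>Since 1 is no root of \<open>bch_gen h \<alpha> \<delta>\<close>, a root of
  \<open>p\<close> at 1 must come from the cofactor.\<close>

lemma tilde_gen_dvd_iff:
  assumes "\<delta> \<le> n"
  shows "[:-1, 1:] * bch_gen h \<alpha> \<delta> dvd p \<longleftrightarrow> vanishes p 1 \<and> bch_gen h \<alpha> \<delta> dvd p"
proof
  assume "vanishes p 1 \<and> bch_gen h \<alpha> \<delta> dvd p"
  then obtain r where r: "p = bch_gen h \<alpha> \<delta> * r" "vanishes p 1"
    using dvdE by blast
  then have "poly p 1 = 0"
    by (metis hom_0_iff hom_one poly_map_poly)
  then have "poly r 1 = 0"
    using r bch_gen_not_vanishes_1[OF assms] by simp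
  then have "[:-1, 1:] dvd r"
    by (simp add: poly_eq_0_iff_dvd)
  then show "[:-1, 1:] * bch_gen h \<alpha> \<delta> dvd p"
    unfolding r by (subst mult.commute) (intro mult_dvd_mono dvd_refl)
next
  assume dvd: "[:-1, 1:] * bch_gen h \<alpha> \<delta> dvd p"
  then have "[:-1, 1:] dvd p"
    by (rule dvd_mult_left)
  then have "poly p 1 = 0"
    by (simp add: poly_eq_0_iff_dvd)
  then have "vanishes p 1"
    by (metis hom_zero hom_one poly_map_poly)
  with dvd show "vanishes p 1 \<and> bch_gen h \<alpha> \<delta> dvd p"
    using dvd_mult_right by blast
qed

lemma ev_zero_coset_below:
  "(\<forall>j. 1 \<le> j \<longrightarrow> j < \<delta> \<longrightarrow> ev c j = 0) \<longleftrightarrow> (\<forall>t. coset_below \<delta> t \<longrightarrow> ev c t = 0)"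
proof (intro iffI allI impI)
  fix t assume zero: "\<forall>j. 1 \<le> j \<longrightarrow> j < \<delta> \<longrightarrow> ev c j = 0" and "coset_below \<delta> t"
  then obtain i k where "1 \<le> i" "i < \<delta>" "[t * q ^ k = i] (mod n)"
    unfolding coset_below_def by blast
  with zero have "ev c t ^ (q ^ k) = 0"
    by (simp add: ev_cong flip: ev_mult_power)
  then show "ev c t = 0" by simp
next
  fix j assume "\<forall>t. coset_below \<delta> t \<longrightarrow> ev c t = 0" "1 \<le> j" "j < \<delta>"
  then show "ev c j = 0"
    using coset_belowI[of j \<delta> 0 j] by simp
qed

lemma bch_code_eq: "bch_code h \<alpha> n \<delta> = zero_code (coset_below \<delta>)"
  unfolding bch_code_def zero_code_def ev_zero_coset_below[symmetric]
  by (auto simp: mem_cyclic_code_iff[OF bch_gen_dvd_x_n_minus_1] bch_gen_dvd_iff vanishes_Poly)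

definition tilde_zeros :: "nat \<Rightarrow> nat \<Rightarrow> bool" where
  "tilde_zeros \<delta> j \<longleftrightarrow> n dvd j \<or> coset_below \<delta> j"

lemma bch_code_tilde_eq:
  assumes "\<delta> \<le> n"
  shows "bch_code_tilde h \<alpha> n \<delta> = zero_code (tilde_zeros \<delta>)"
proof -
  have dvd: "[:-1, 1:] * bch_gen h \<alpha> \<delta> dvd monom 1 n - 1"
    unfolding tilde_gen_dvd_iff[OF assms]
    using vanishes_x_n_minus_1[of 0, unfolded power_0] bch_gen_dvd_x_n_minus_1 by blast
  have "[:-1, 1:] * bch_gen h \<alpha> \<delta> dvd Poly (list_of_vec c) \<longleftrightarrow> (\<forall>t. tilde_zeros \<delta> t \<longrightarrow> ev c t = 0)"
    if c: "c \<in> carrier_vec n" for c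
  proof -
    have "vanishes (Poly (list_of_vec c)) 1 \<longleftrightarrow> ev c 0 = 0"
      using vanishes_Poly[OF c, of 0] by simp
    also have "\<dots> \<longleftrightarrow> (\<forall>t. n dvd t \<longrightarrow> ev c t = 0)"
      by (metis cong_0_iff ev_cong dvd_0_right)
    finally show ?thesis
      unfolding tilde_gen_dvd_iff[OF assms] bch_gen_dvd_iff vanishes_Poly[OF c] ev_zero_coset_below
        tilde_zeros_def by blast
  qed
  then show ?thesis
    unfolding bch_code_tilde_def zero_code_def using mem_cyclic_code_iff[OF dvd] by blast
qed

lemma conj_closed_coset_below: "conj_closed (coset_below \<delta>)"
  unfolding conj_closed_def using coset_below_cong_mult by blast

lemma conj_closed_tilde_zeros: "conj_closed (tilde_zeros \<delta>)"
  unfolding conj_closed_def tilde_zeros_def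
  using coset_below_cong_mult cong_dvd_iff dvd_mult2 by metis

text \<open>Multiples of \<open>n\<close> are on neither side: \<open>tilde_zeros\<close> contains
  0, and \<open>\<delta>' \<le> n\<close> keeps them out of \<open>coset_below \<delta>'\<close>.
  Only nonzero residues remain to be compared.\<close>

lemma dual_zeros_tilde_iff:
  assumes "\<delta>' \<le> n"
  shows "dual_zeros (tilde_zeros \<delta>) = coset_below \<delta>' \<longleftrightarrow> complementary \<delta> \<delta>'"
proof
  assume eq: "dual_zeros (tilde_zeros \<delta>) = coset_below \<delta>'"
  show "complementary \<delta> \<delta>'"
    unfolding complementary_def eq[symmetric] dual_zeros_def tilde_zeros_def
  proof (intro allI impI)
    fix j t assume jt: "n dvd j + t" "\<not> n dvd j"
    have "(\<not> (n dvd t' \<or> coset_below \<delta> t')) \<longleftrightarrow> \<not> coset_below \<delta> t" if "n dvd j + t'" for t'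
    proof -
      have "[t' = t] (mod n)"
        using cong_neg[OF that jt(1)] by simp
      moreover have "\<not> n dvd t'"
        using that jt(2) dvd_add_left_iff by blast
      ultimately show ?thesis
        using coset_below_cong by blast
    qed
    with jt(1) show "(\<forall>t. n dvd j + t \<longrightarrow> \<not> (n dvd t \<or> coset_below \<delta> t)) \<longleftrightarrow> \<not> coset_below \<delta> t"
      by blast
  qed
next
  assume compl: "complementary \<delta> \<delta>'"
  have "dual_zeros (tilde_zeros \<delta>) j \<longleftrightarrow> coset_below \<delta>' j" for j
  proof (cases "n dvd j")
    case True
    then have "\<not> dual_zeros (tilde_zeros \<delta>) j"
      by (auto simp: dual_zeros_def tilde_zeros_def intro!: exI[of _ 0])
    with True not_coset_below_dvd[OF assms] show ?thesis by blast
  next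
    case False
    have "\<not> n dvd t" if "n dvd j + t" for t
      using that False dvd_add_left_iff by blast
    with False dvd_neg[of j] complementaryD[OF compl] show ?thesis
      unfolding dual_zeros_def tilde_zeros_def by metis
  qed
  then show "dual_zeros (tilde_zeros \<delta>) = coset_below \<delta>'" by blast
qed

theorem dual_bch_code_tilde_iff:
  assumes "2 \<le> \<delta>" "\<delta> \<le> n"
  shows "is_narrow_sense_bch h \<alpha> n (dual_code n (bch_code_tilde h \<alpha> n \<delta>)) \<longleftrightarrow>
    \<delta> = 2 \<or> (\<delta>2 < \<delta> \<and> \<delta> \<le> \<delta>1)"
proof -
  have "dual_code n (bch_code_tilde h \<alpha> n \<delta>) = bch_code h \<alpha> n \<delta>' \<longleftrightarrow> complementary \<delta> \<delta>'"
    if "\<delta>' \<le> n" for \<delta>'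
    by (simp add: bch_code_tilde_eq assms bch_code_eq dual_zero_code conj_closed_tilde_zeros
        zero_code_eq_iff conj_closed_dual_zeros conj_closed_coset_below dual_zeros_tilde_iff that)
  then show ?thesis
    unfolding is_narrow_sense_bch_def ex_complementary_iff[OF assms(1), symmetric] by blast
qed

end

theorem theorem15:
  fixes h :: "'a::{finite, field_gcd} \<Rightarrow> 'b::{finite, field}"
    and \<alpha> :: 'b
    and q m n \<delta> :: nat
  assumes "field_hom h"
    and "CARD('a) = q"
    and "CARD('b) = q ^ m"
    and "q \<ge> 3"
    and "m \<ge> 2"
    and "n = q ^ m - 1"
    and "range (\<lambda>k::nat. \<alpha> ^ k) = UNIV - {0}"
    and "2 \<le> \<delta>"
    and "\<delta> \<le> n"
  shows "is_narrow_sense_bch h \<alpha> n (dual_code n (bch_code_tilde h \<alpha> n \<delta>)) \<longleftrightarrow>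
    \<delta> = 2 \<or>
    ((q - 1) * q ^ (m - 1) - q ^ ((m - 1) div 2) \<le> \<delta> \<and> \<delta> \<le> (q - 1) * q ^ (m - 1) - 1)"
proof -
  interpret field_hom h by fact
  interpret bch_field h q m n \<alpha>
    by unfold_locales (use assms in auto)
  show ?thesis
    unfolding leader_formulas using dual_bch_code_tilde_iff[OF assms(8,9)] by (simp add: Suc_le_eq)
qed

end
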